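(* Let $\mathcal{G}$ be a finite undirected graph, regarded as a 1-dimensional topological space, let $I = [t_s, t_e] \subset \mathbb{R}$ (with $t_s \le t_e$) be a closed interval, and let $\mathcal{G} \times I$ be the product topological space. Given any choice of $t_0 \in I$, let $\pi_{t_0} : \mathcal{G} \times I \to \mathcal{G} \times \{t_0\} \cong \mathcal{G}$, $(g,t) \mapsto (g,t_0)$, be the projection map which sends the interval $I$ to the singleton $\{t_0\}$. Let $\mathcal{C}_{\mathcal{G} \times I} := \{C_1, C_2, \dots, C_n\}$ be a cycle basis of the topological space $\mathcal{G} \times I$. Then the set $$\pi_{t_0}\left(\mathcal{C}_{\mathcal{G} \times I}\right) := \{\pi_{t_0}(C_1), \dots, \pi_{t_0}(C_n)\}$$ is a cycle basis of $\mathcal{G}$.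
   Context: A graph $\mathcal{G} = (\mathcal{V}, \mathcal{E})$ with finite vertex set $\mathcal{V} = \{v_1,\dots,v_N\}$ and edge set $\mathcal{E} \subseteq \mathcal{V} \times \mathcal{V}$, viewed as undirected, is identified with its geometric realization, a 1-dimensional CW complex. (In the application, $\mathcal{G}$ is a traffic network and $I$ is the time interval over which measurements are taken.) Cycle basis: for a topological space $Y$ (here $Y = \mathcal{G}$ or $Y = \mathcal{G} \times I$), a cycle in $Y$ is a closed loop, i.e. a continuous map $C : S^1 \to Y$, and it determines a class $[C] \in H_1(Y; \mathbb{Q})$, the image under $C_*$ of a fixed generator of $H_1(S^1;\mathbb{Z})$, taken with rational coefficients. A finite collection $\{C_1, \dots, C_n\}$ of cycles in $Y$ is a cycle basis of $Y$ if the classes $[C_1], \dots, [C_n]$ form a basis of the $\mathbb{Q}$-vector space $H_1(Y; \mathbb{Q})$ (for a graph, this space is its cycle space). For a cycle $C$ in $\mathcal{G} \times I$, $\pi_{t_0}(C)$ denotes the composite loop $\pi_{t_0} \circ C$, regarded as a cycle in $\mathcal{G}$ through the identification $\mathcal{G} \times \{t_0\} \cong \mathcal{G}$. *)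

theory Defs
  imports
    "HOL-Homology.Homology"
    "Jordan_Normal_Form.VS_Connect"
begin


section \<open>Geometric realization of a finite undirected graph\<close>

definition quotient_topology :: "'a topology \<Rightarrow> ('a \<Rightarrow> 'b) \<Rightarrow> 'b topology" where
  "quotient_topology X f =
     topology (\<lambda>U. U \<subseteq> f ` topspace X \<and> openin X {x \<in> topspace X. f x \<in> U})"

lemma openin_quotient_topology:
  "openin (quotient_topology X f) U \<longleftrightarrow>
     U \<subseteq> f ` topspace X \<and> openin X {x \<in> topspace X. f x \<in> U}"
proof -
  have "istopology (\<lambda>U. U \<subseteq> f ` topspace X \<and> openin X {x \<in> topspace X. f x \<in> U})"
    unfolding istopology_def
  proof (intro conjI allI impI)
    fix S T
    assume "S \<subseteq> f ` topspace X \<and> openin X {x \<in> topspace X. f x \<in> S}"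
      "T \<subseteq> f ` topspace X \<and> openin X {x \<in> topspace X. f x \<in> T}"
    moreover have "{x \<in> topspace X. f x \<in> S \<inter> T} =
        {x \<in> topspace X. f x \<in> S} \<inter> {x \<in> topspace X. f x \<in> T}"
      by auto
    ultimately show "S \<inter> T \<subseteq> f ` topspace X" "openin X {x \<in> topspace X. f x \<in> S \<inter> T}"
      by auto
  next
    fix K
    assume K: "\<forall>S\<in>K. S \<subseteq> f ` topspace X \<and> openin X {x \<in> topspace X. f x \<in> S}"
    have "{x \<in> topspace X. f x \<in> \<Union> K} = (\<Union>S\<in>K. {x \<in> topspace X. f x \<in> S})"
      by auto
    with K show "\<Union> K \<subseteq> f ` topspace X" "openin X {x \<in> topspace X. f x \<in> \<Union> K}"
      by auto
  qed
  then show ?thesis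
    by (simp add: quotient_topology_def)
qed

lemma topspace_quotient_topology [simp]:
  "topspace (quotient_topology X f) = f ` topspace X"
proof
  show "topspace (quotient_topology X f) \<subseteq> f ` topspace X"
    using openin_quotient_topology [of X f] by (metis openin_topspace)
  have "{x \<in> topspace X. f x \<in> f ` topspace X} = topspace X"
    by auto
  then have "openin (quotient_topology X f) (f ` topspace X)"
    by (simp add: openin_quotient_topology)
  then show "f ` topspace X \<subseteq> topspace (quotient_topology X f)"
    by (rule openin_subset)
qed

lemma quotient_map_quotient_topology: "quotient_map X (quotient_topology X f) f"
  by (auto simp: quotient_map_def openin_quotient_topology)

text \<open>
  The realization is assembled from the disjoint union of one point for each vertex and one copy
  of the unit interval for each pair in the edge set.
\<close>

definition graph_cells :: "'v set \<Rightarrow> ('v \<times> 'v) set \<Rightarrow> (('v + 'v \<times> 'v) \<times> real) topology" where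
  "graph_cells V E =
     sum_topology (\<lambda>c. case c of Inl v \<Rightarrow> top_of_set {0} | Inr e \<Rightarrow> top_of_set {0..1}) (V <+> E)"

text \<open>
  The interval of \<open>(u, v)\<close> runs from \<open>u\<close> to \<open>v\<close>. The last clause makes \<open>(u, v)\<close> and \<open>(v, u)\<close> one
  undirected edge. It is restricted to \<open>u \<noteq> v\<close>, because on a self-loop it would fold the circle
  into an arc.
\<close>

definition graph_glue ::
    "('v \<times> 'v) set \<Rightarrow> ((('v + 'v \<times> 'v) \<times> real) \<times> (('v + 'v \<times> 'v) \<times> real)) set" where
  "graph_glue E =
     {((Inr (u, v), 0), (Inl u, 0)) | u v. (u, v) \<in> E} \<union>
     {((Inr (u, v), 1), (Inl v, 0)) | u v. (u, v) \<in> E} \<union>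
     {((Inr (u, v), t), (Inr (v, u), 1 - t)) | u v t.
        (u, v) \<in> E \<and> (v, u) \<in> E \<and> u \<noteq> v \<and> t \<in> {0..1}}"

definition graph_space ::
    "'v set \<Rightarrow> ('v \<times> 'v) set \<Rightarrow> (('v + 'v \<times> 'v) \<times> real) set topology" where
  "graph_space V E =
     quotient_topology (graph_cells V E) (\<lambda>x. (graph_glue E \<union> (graph_glue E)\<inverse>)\<^sup>* `` {x})"


section \<open>Singular homology with rational coefficients\<close>

type_synonym 'a rat_chain = "((nat \<Rightarrow> real) \<Rightarrow> 'a) \<Rightarrow>\<^sub>0 rat"

definition rat_chain_scale :: "rat \<Rightarrow> 'a rat_chain \<Rightarrow> 'a rat_chain" where
  "rat_chain_scale q = Poly_Mapping.map ((*) q)"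

definition rat_of_chain :: "'a chain \<Rightarrow> 'a rat_chain" where
  "rat_of_chain = Poly_Mapping.map rat_of_int"

definition rat_chain_boundary :: "nat \<Rightarrow> 'a rat_chain \<Rightarrow> 'a rat_chain" where
  "rat_chain_boundary p c =
     (\<Sum>\<sigma>\<in>Poly_Mapping.keys c.
        rat_chain_scale (Poly_Mapping.lookup c \<sigma>) (rat_of_chain (chain_boundary p (frag_of \<sigma>))))"

definition rat_singular_chains :: "nat \<Rightarrow> 'a topology \<Rightarrow> 'a rat_chain set" where
  "rat_singular_chains p Y = {c. Poly_Mapping.keys c \<subseteq> singular_simplex_set p Y}"

definition rat_singular_cycles :: "nat \<Rightarrow> 'a topology \<Rightarrow> 'a rat_chain set" where
  "rat_singular_cycles p Y = {c \<in> rat_singular_chains p Y. rat_chain_boundary p c = 0}"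

definition rat_singular_boundaries :: "nat \<Rightarrow> 'a topology \<Rightarrow> 'a rat_chain set" where
  "rat_singular_boundaries p Y = rat_chain_boundary (Suc p) ` rat_singular_chains (Suc p) Y"

text \<open>The record type \<^typ>\<open>('a, 'b) module\<close> also has multiplicative fields; they carry no meaning here.\<close>

definition rat_cycle_module :: "nat \<Rightarrow> 'a topology \<Rightarrow> (rat, 'a rat_chain) module" where
  "rat_cycle_module p Y =
     \<lparr>carrier = rat_singular_cycles p Y, mult = undefined, one = undefined,
      zero = 0, add = (+), smult = rat_chain_scale\<rparr>"

definition quotient_module :: "('r, 'm) module \<Rightarrow> 'm set \<Rightarrow> ('r, 'm set) module" where
  "quotient_module M N =
     \<lparr>carrier = a_rcosets\<^bsub>M\<^esub> N, mult = undefined, one = undefined,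
      zero = N, add = set_add M, smult = (\<lambda>r A. \<Union>a\<in>A. N +>\<^bsub>M\<^esub> (r \<odot>\<^bsub>M\<^esub> a))\<rparr>"

definition rat_homology :: "nat \<Rightarrow> 'a topology \<Rightarrow> (rat, 'a rat_chain set) module" where
  "rat_homology p Y = quotient_module (rat_cycle_module p Y) (rat_singular_boundaries p Y)"

text \<open>
  The coefficient map from integral to rational homology. An element of the library's
  \<^const>\<open>homology_group\<close> is a coset of integral chains, and the union below is the single coset of
  rational boundaries containing all their images.
\<close>

definition rat_homology_class :: "nat \<Rightarrow> 'a topology \<Rightarrow> 'a chain set \<Rightarrow> 'a rat_chain set" where
  "rat_homology_class p Y A =
     (\<Union>z\<in>A. rat_singular_boundaries p Y +>\<^bsub>rat_cycle_module p Y\<^esub> rat_of_chain z)"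

lemma lookup_rat_chain_scale [simp]:
  "Poly_Mapping.lookup (rat_chain_scale q c) \<sigma> = q * Poly_Mapping.lookup c \<sigma>"
  by (simp add: rat_chain_scale_def Poly_Mapping.map.rep_eq when_def)

lemma lookup_rat_of_chain [simp]:
  "Poly_Mapping.lookup (rat_of_chain c) \<sigma> = of_int (Poly_Mapping.lookup c \<sigma>)"
  by (simp add: rat_of_chain_def Poly_Mapping.map.rep_eq when_def)

lemma rat_chain_scale_simps [simp]:
  "rat_chain_scale 0 c = 0" "rat_chain_scale 1 c = c" "rat_chain_scale q 0 = 0"
  "rat_chain_scale q (rat_chain_scale r c) = rat_chain_scale (q * r) c"
  by (auto intro!: poly_mapping_eqI simp: algebra_simps)

lemma rat_chain_scale_add:
  "rat_chain_scale (q + r) c = rat_chain_scale q c + rat_chain_scale r c"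
  "rat_chain_scale q (c + d) = rat_chain_scale q c + rat_chain_scale q d"
  by (auto intro!: poly_mapping_eqI simp: algebra_simps Poly_Mapping.lookup_add)

lemma rat_chain_scale_sum: "rat_chain_scale q (sum f S) = (\<Sum>i\<in>S. rat_chain_scale q (f i))"
  by (induction S rule: infinite_finite_induct) (auto simp: rat_chain_scale_add)

lemma rat_chain_boundary_superset:
  assumes "finite S" "Poly_Mapping.keys c \<subseteq> S"
  shows "rat_chain_boundary p c =
     (\<Sum>\<sigma>\<in>S. rat_chain_scale (Poly_Mapping.lookup c \<sigma>) (rat_of_chain (chain_boundary p (frag_of \<sigma>))))"
  unfolding rat_chain_boundary_def using assms
  by (intro sum.mono_neutral_left) (auto simp: in_keys_iff)

lemma rat_chain_boundary_0 [simp]: "rat_chain_boundary p 0 = 0"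
  by (simp add: rat_chain_boundary_def)

lemma rat_chain_boundary_add:
  "rat_chain_boundary p (c + d) = rat_chain_boundary p c + rat_chain_boundary p d"
proof -
  let ?S = "Poly_Mapping.keys c \<union> Poly_Mapping.keys d"
  have "Poly_Mapping.keys (c + d) \<subseteq> ?S"
    by (rule Poly_Mapping.keys_add)
  then have "rat_chain_boundary p (c + d) = (\<Sum>\<sigma>\<in>?S. rat_chain_scale
      (Poly_Mapping.lookup (c + d) \<sigma>) (rat_of_chain (chain_boundary p (frag_of \<sigma>))))"
    by (intro rat_chain_boundary_superset) simp_all
  then show ?thesis
    by (simp add: rat_chain_boundary_superset [of ?S c] rat_chain_boundary_superset [of ?S d]
        Poly_Mapping.lookup_add rat_chain_scale_add(1) sum.distrib)
qed

lemma keys_rat_chain_scale: "Poly_Mapping.keys (rat_chain_scale q c) \<subseteq> Poly_Mapping.keys c"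
  by (auto simp: in_keys_iff)

lemma rat_chain_boundary_scale:
  "rat_chain_boundary p (rat_chain_scale q c) = rat_chain_scale q (rat_chain_boundary p c)"
proof -
  have "rat_chain_boundary p (rat_chain_scale q c) = (\<Sum>\<sigma>\<in>Poly_Mapping.keys c. rat_chain_scale
      (Poly_Mapping.lookup (rat_chain_scale q c) \<sigma>) (rat_of_chain (chain_boundary p (frag_of \<sigma>))))"
    using keys_rat_chain_scale by (rule rat_chain_boundary_superset [OF finite_keys])
  then show ?thesis
    by (simp add: rat_chain_boundary_def [of p c] rat_chain_scale_sum)
qed

lemma rat_chain_boundary_sum:
  "rat_chain_boundary p (sum f S) = (\<Sum>i\<in>S. rat_chain_boundary p (f i))"
  by (induction S rule: infinite_finite_induct) (auto simp: rat_chain_boundary_add)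

lemma rat_chain_boundary_of_chain:
  "rat_chain_boundary p (rat_of_chain c) = rat_of_chain (chain_boundary p c)"
  using subset_UNIV
proof (induction c rule: frag_induction)
  case zero
  have "rat_of_chain (0 :: 'a chain) = 0"
    by (auto intro!: poly_mapping_eqI)
  then show ?case by simp
next
  case (one \<sigma>)
  have "Poly_Mapping.keys (rat_of_chain (frag_of \<sigma>)) \<subseteq> {\<sigma>}"
    by (auto simp: in_keys_iff lookup_single when_def split: if_splits)
  then show ?case
    by (simp add: rat_chain_boundary_superset [of "{\<sigma>}"])
next
  case (diff a b)
  have *: "rat_of_chain (x - y) = rat_of_chain x + rat_chain_scale (-1) (rat_of_chain y)"
    for x y :: "'a chain"
    by (auto intro!: poly_mapping_eqI simp: Poly_Mapping.lookup_add Poly_Mapping.lookup_minus)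
  from diff show ?case
    by (simp add: * rat_chain_boundary_add rat_chain_boundary_scale chain_boundary_diff)
qed

lemma rat_chain_boundary_boundary:
  assumes "c \<in> rat_singular_chains (Suc p) Y"
  shows "rat_chain_boundary p (rat_chain_boundary (Suc p) c) = 0"
proof -
  have "chain_boundary p (chain_boundary (Suc p) (frag_of \<sigma>)) = 0"
    if "\<sigma> \<in> Poly_Mapping.keys c" for \<sigma>
    using assms that
    by (intro chain_boundary_boundary_alt [of p Y]) (auto simp: rat_singular_chains_def singular_chain_of)
  moreover have "rat_of_chain (0 :: 'a chain) = 0"
    by (auto intro!: poly_mapping_eqI)
  ultimately show ?thesis
    unfolding rat_chain_boundary_def [of "Suc p"]
    by (simp add: rat_chain_boundary_sum rat_chain_boundary_scale rat_chain_boundary_of_chain)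
qed

lemma rat_chain_boundary_chains:
  assumes "c \<in> rat_singular_chains (Suc p) Y"
  shows "rat_chain_boundary (Suc p) c \<in> rat_singular_chains p Y"
proof -
  have "Poly_Mapping.keys (rat_chain_scale q (rat_of_chain (chain_boundary (Suc p) (frag_of \<sigma>))))
        \<subseteq> singular_simplex_set p Y" if "\<sigma> \<in> Poly_Mapping.keys c" for q \<sigma>
  proof -
    have "singular_chain p Y (chain_boundary (Suc p) (frag_of \<sigma>))"
      using assms that
      by (intro singular_chain_boundary_alt) (auto simp: rat_singular_chains_def singular_chain_of)
    then show ?thesis
      by (auto simp: singular_chain_def in_keys_iff)
  qed
  then show ?thesis
    unfolding rat_singular_chains_def rat_chain_boundary_def
    using keys_sum by fastforce
qed

lemma rat_singular_chains_closed [simp]: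
  "0 \<in> rat_singular_chains p Y"
  "c \<in> rat_singular_chains p Y \<Longrightarrow> d \<in> rat_singular_chains p Y \<Longrightarrow> c + d \<in> rat_singular_chains p Y"
  "c \<in> rat_singular_chains p Y \<Longrightarrow> rat_chain_scale q c \<in> rat_singular_chains p Y"
  using Poly_Mapping.keys_add [of c d] keys_rat_chain_scale [of q c]
  by (auto simp: rat_singular_chains_def)

lemma rat_singular_cycles_closed [simp]:
  "0 \<in> rat_singular_cycles p Y"
  "c \<in> rat_singular_cycles p Y \<Longrightarrow> d \<in> rat_singular_cycles p Y \<Longrightarrow> c + d \<in> rat_singular_cycles p Y"
  "c \<in> rat_singular_cycles p Y \<Longrightarrow> rat_chain_scale q c \<in> rat_singular_cycles p Y"
  by (auto simp: rat_singular_cycles_def rat_chain_boundary_add rat_chain_boundary_scale)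

lemma rat_singular_boundaries_closed [simp]:
  "0 \<in> rat_singular_boundaries p Y"
  "c \<in> rat_singular_boundaries p Y \<Longrightarrow> d \<in> rat_singular_boundaries p Y
     \<Longrightarrow> c + d \<in> rat_singular_boundaries p Y"
  "c \<in> rat_singular_boundaries p Y \<Longrightarrow> rat_chain_scale q c \<in> rat_singular_boundaries p Y"
proof -
  have "rat_chain_boundary (Suc p) 0 \<in> rat_singular_boundaries p Y"
    unfolding rat_singular_boundaries_def by (rule imageI) (rule rat_singular_chains_closed)
  then show "0 \<in> rat_singular_boundaries p Y"
    by (simp only: rat_chain_boundary_0)
next
  assume "c \<in> rat_singular_boundaries p Y" "d \<in> rat_singular_boundaries p Y"
  then obtain c' d' where "c = rat_chain_boundary (Suc p) c'" "c' \<in> rat_singular_chains (Suc p) Y"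
      "d = rat_chain_boundary (Suc p) d'" "d' \<in> rat_singular_chains (Suc p) Y"
    unfolding rat_singular_boundaries_def by blast
  then show "c + d \<in> rat_singular_boundaries p Y"
    unfolding rat_singular_boundaries_def
    by (intro image_eqI [of _ _ "c' + d'"])
       (simp_all only: rat_chain_boundary_add rat_singular_chains_closed)
next
  assume "c \<in> rat_singular_boundaries p Y"
  then obtain c' where "c = rat_chain_boundary (Suc p) c'" "c' \<in> rat_singular_chains (Suc p) Y"
    unfolding rat_singular_boundaries_def by blast
  then show "rat_chain_scale q c \<in> rat_singular_boundaries p Y"
    unfolding rat_singular_boundaries_def
    by (intro image_eqI [of _ _ "rat_chain_scale q c'"])
       (simp_all only: rat_chain_boundary_scale rat_singular_chains_closed)
qed

lemma rat_singular_boundaries_subset: "rat_singular_boundaries p Y \<subseteq> rat_singular_cycles p Y"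
  by (auto simp: rat_singular_boundaries_def rat_singular_cycles_def rat_chain_boundary_chains
      rat_chain_boundary_boundary)

abbreviation rat_coset :: "nat \<Rightarrow> 'a topology \<Rightarrow> 'a rat_chain \<Rightarrow> 'a rat_chain set" where
  "rat_coset p Y z \<equiv> rat_singular_boundaries p Y +>\<^bsub>rat_cycle_module p Y\<^esub> z"

lemma rat_coset_eq: "rat_coset p Y z = (\<lambda>b. b + z) ` rat_singular_boundaries p Y"
  by (auto simp: a_r_coset_def r_coset_def rat_cycle_module_def)

lemma rat_coset_cong:
  assumes "b \<in> rat_singular_boundaries p Y"
  shows "rat_coset p Y (b + z) = rat_coset p Y z"
proof -
  have m: "- b \<in> rat_singular_boundaries p Y"
  proof -
    have "- b = rat_chain_scale (-1) b" by (auto intro!: poly_mapping_eqI)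
    then show ?thesis using assms by simp
  qed
  have "c + (b + z) \<in> (\<lambda>b. b + z) ` rat_singular_boundaries p Y"
    if "c \<in> rat_singular_boundaries p Y" for c
    using assms that by (intro image_eqI [of _ _ "c + b"]) (simp_all add: add.assoc)
  moreover have "c + z \<in> (\<lambda>c. c + (b + z)) ` rat_singular_boundaries p Y"
    if "c \<in> rat_singular_boundaries p Y" for c
    using m that rat_singular_boundaries_closed(2) [OF that m]
    by (intro image_eqI [of _ _ "c + - b"]) simp_all
  ultimately show ?thesis
    unfolding rat_coset_eq by (intro equalityI image_subsetI)
qed

lemma rat_homology_simps:
  "carrier (rat_homology p Y) = rat_coset p Y ` rat_singular_cycles p Y"
  "\<zero>\<^bsub>rat_homology p Y\<^esub> = rat_coset p Y 0"
  "rat_coset p Y w \<oplus>\<^bsub>rat_homology p Y\<^esub> rat_coset p Y z = rat_coset p Y (w + z)"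
  "q \<odot>\<^bsub>rat_homology p Y\<^esub> rat_coset p Y z = rat_coset p Y (rat_chain_scale q z)"
proof -
  show "carrier (rat_homology p Y) = rat_coset p Y ` rat_singular_cycles p Y"
    unfolding rat_homology_def quotient_module_def A_RCOSETS_def RCOSETS_def a_r_coset_def
    by (simp add: rat_cycle_module_def UNION_singleton_eq_range)
  show "\<zero>\<^bsub>rat_homology p Y\<^esub> = rat_coset p Y 0"
    by (simp add: rat_coset_eq rat_homology_def quotient_module_def)
  have "rat_coset p Y w \<oplus>\<^bsub>rat_homology p Y\<^esub> rat_coset p Y z =
      (\<Union>b\<in>rat_singular_boundaries p Y. \<Union>c\<in>rat_singular_boundaries p Y. {(b + w) + (c + z)})"
    unfolding rat_homology_def quotient_module_def
    by (simp add: set_add_def set_mult_def rat_coset_eq) (simp add: rat_cycle_module_def)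
  also have "\<dots> = (\<lambda>b. b + (w + z)) ` rat_singular_boundaries p Y"
  proof (intro equalityI subsetI)
    fix x
    assume "x \<in> (\<Union>b\<in>rat_singular_boundaries p Y. \<Union>c\<in>rat_singular_boundaries p Y. {(b + w) + (c + z)})"
    then obtain b c where "b \<in> rat_singular_boundaries p Y" "c \<in> rat_singular_boundaries p Y"
      "x = (b + w) + (c + z)"
      by blast
    then show "x \<in> (\<lambda>b. b + (w + z)) ` rat_singular_boundaries p Y"
      by (intro image_eqI [of _ _ "b + c"]) (simp_all add: ac_simps)
  next
    fix x
    assume "x \<in> (\<lambda>b. b + (w + z)) ` rat_singular_boundaries p Y"
    then obtain b where b: "b \<in> rat_singular_boundaries p Y" "x = (b + w) + (0 + z)"
      by (auto simp: add.assoc)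
    then show "x \<in> (\<Union>b\<in>rat_singular_boundaries p Y. \<Union>c\<in>rat_singular_boundaries p Y. {(b + w) + (c + z)})"
      using rat_singular_boundaries_closed(1) by blast
  qed
  finally show "rat_coset p Y w \<oplus>\<^bsub>rat_homology p Y\<^esub> rat_coset p Y z = rat_coset p Y (w + z)"
    by (simp only: rat_coset_eq)
  have "q \<odot>\<^bsub>rat_homology p Y\<^esub> rat_coset p Y z =
      (\<Union>a\<in>rat_coset p Y z. rat_coset p Y (rat_chain_scale q a))"
    unfolding rat_homology_def quotient_module_def by (simp add: rat_cycle_module_def)
  also have "\<dots> = rat_coset p Y (rat_chain_scale q z)"
  proof (rule SUP_eq_const)
    show "rat_coset p Y z \<noteq> {}"
      unfolding rat_coset_eq using rat_singular_boundaries_closed(1) by blast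
    fix a
    assume "a \<in> rat_coset p Y z"
    then obtain b where "b \<in> rat_singular_boundaries p Y" "a = b + z"
      unfolding rat_coset_eq by blast
    then show "rat_coset p Y (rat_chain_scale q a) = rat_coset p Y (rat_chain_scale q z)"
      by (simp only: rat_chain_scale_add rat_coset_cong rat_singular_boundaries_closed)
  qed
  finally show "q \<odot>\<^bsub>rat_homology p Y\<^esub> rat_coset p Y z = rat_coset p Y (rat_chain_scale q z)" .
qed

lemma vectorspace_rat_homology: "vectorspace (class_ring :: rat ring) (rat_homology p Y)"
proof (intro vectorspace.intro moduleI abelian_groupI)
  show "cring (class_ring :: rat ring)" "field (class_ring :: rat ring)"
    by (fact class_cring.cring_axioms class_field.field_axioms)+
next
  fix x assume "x \<in> carrier (rat_homology p Y)"
  then obtain z where z: "z \<in> rat_singular_cycles p Y" "x = rat_coset p Y z"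
    by (auto simp: rat_homology_simps)
  moreover have "rat_chain_scale (-1) z + z = 0"
    by (auto intro!: poly_mapping_eqI simp: Poly_Mapping.lookup_add)
  ultimately show "\<exists>y\<in>carrier (rat_homology p Y). y \<oplus>\<^bsub>rat_homology p Y\<^esub> x = \<zero>\<^bsub>rat_homology p Y\<^esub>"
    by (intro bexI [of _ "rat_coset p Y (rat_chain_scale (-1) z)"])
       (auto simp: rat_homology_simps)
qed (auto simp: rat_homology_simps rat_chain_scale_add add_ac)

lemma rat_homology_class_coset:
  "rat_homology_class p Y (homologous_rel_set p Y {} z) = rat_coset p Y (rat_of_chain z)"
proof -
  have "rat_coset p Y (rat_of_chain w) = rat_coset p Y (rat_of_chain z)"
    if w: "homologous_rel p Y {} z w" for w
  proof -
    obtain d where d: "singular_chain (Suc p) Y d" "z - w = chain_boundary (Suc p) d"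
      using w unfolding homologous_rel_def singular_boundary by metis
    have "rat_of_chain d \<in> rat_singular_chains (Suc p) Y"
      using d(1) by (auto simp: rat_singular_chains_def singular_chain_def in_keys_iff)
    then have "rat_of_chain (z - w) \<in> rat_singular_boundaries p Y"
      unfolding d(2) rat_singular_boundaries_def rat_chain_boundary_of_chain [symmetric]
      by (rule imageI)
    moreover have "rat_of_chain z = rat_of_chain (z - w) + rat_of_chain w"
      by (auto intro!: poly_mapping_eqI simp: Poly_Mapping.lookup_add Poly_Mapping.lookup_minus)
    ultimately show ?thesis
      by (simp only: rat_coset_cong)
  qed
  moreover have "z \<in> homologous_rel_set p Y {} z"
    by simp
  ultimately show ?thesis
    unfolding rat_homology_class_def by (intro SUP_eq_const) blast+
qed


section \<open>Cycle bases\<close>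

definition circle_generator :: "(nat \<Rightarrow> real) chain set \<Rightarrow> bool" where
  "circle_generator \<gamma> \<longleftrightarrow>
     \<gamma> \<in> carrier (homology_group 1 (nsphere 1)) \<and>
     subgroup_generated (homology_group 1 (nsphere 1)) {\<gamma>} = homology_group 1 (nsphere 1)"

lemma circle_generator_exists: "\<exists>\<gamma>. circle_generator \<gamma>"
  using cyclic_reduced_homology_group_nsphere [of 1 1] un_reduced_homology_group [of 1 "nsphere 1"]
  by (auto simp: circle_generator_def cyclic_group_def)

definition loop_class ::
    "(nat \<Rightarrow> real) chain set \<Rightarrow> 'a topology \<Rightarrow> ((nat \<Rightarrow> real) \<Rightarrow> 'a) \<Rightarrow> 'a rat_chain set" where
  "loop_class \<gamma> Y C = rat_homology_class 1 Y (hom_induced 1 (nsphere 1) {} Y {} C \<gamma>)"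

text \<open>
  The classes form a basis as a family: injectivity rules out a collection in which distinct
  members are homologous.
\<close>

definition cycle_basis ::
    "(nat \<Rightarrow> real) chain set \<Rightarrow> 'a topology \<Rightarrow> nat \<Rightarrow> (nat \<Rightarrow> (nat \<Rightarrow> real) \<Rightarrow> 'a) \<Rightarrow> bool" where
  "cycle_basis \<gamma> Y n C \<longleftrightarrow>
     (\<forall>i\<in>{1..n}. continuous_map (nsphere 1) Y (C i)) \<and>
     inj_on (\<lambda>i. loop_class \<gamma> Y (C i)) {1..n} \<and>
     vectorspace.basis (class_ring :: rat ring) (rat_homology 1 Y)
       ((\<lambda>i. loop_class \<gamma> Y (C i)) ` {1..n})"

definition time_slice :: "real \<Rightarrow> 'a \<times> real \<Rightarrow> 'a \<times> real" where
  "time_slice t\<^sub>0 = (\<lambda>(g, t). (g, t\<^sub>0))"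

end

theory Submission
  imports Defs
begin

text \<open>
  The projection \<open>X \<times> I \<rightarrow> X\<close> is a homotopy equivalence, since \<open>I\<close> is contractible, and a homotopy
  equivalence induces an isomorphism in rational homology, which carries the classes of a cycle
  basis to the classes of the composite loops. Homotopy invariance with rational coefficients is
  reduced to the integral case by clearing denominators: a rational cycle is a rational multiple of
  an integral one, and likewise for boundaries.
\<close>

section \<open>Clearing denominators\<close>

lemma rat_of_chain_0 [simp]: "rat_of_chain 0 = 0"
  by (auto intro!: poly_mapping_eqI)

lemma rat_of_chain_diff: "rat_of_chain (a - b) = rat_of_chain a - rat_of_chain b"
  by (auto intro!: poly_mapping_eqI simp: Poly_Mapping.lookup_minus)

lemma rat_chain_scale_diff:
  "rat_chain_scale q (c - d) = rat_chain_scale q c - rat_chain_scale q d"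
  by (auto intro!: poly_mapping_eqI simp: Poly_Mapping.lookup_minus right_diff_distrib)

lemma rat_of_chain_eq_0_iff [simp]: "rat_of_chain c = 0 \<longleftrightarrow> c = 0"
proof
  assume "rat_of_chain c = 0"
  then have "of_int (Poly_Mapping.lookup c \<sigma>) = (0 :: rat)" for \<sigma>
    using lookup_rat_of_chain [of c \<sigma>] by simp
  then show "c = 0"
    by (auto intro!: poly_mapping_eqI)
qed simp

lemma rat_chain_scale_eq_0_iff [simp]: "rat_chain_scale q c = 0 \<longleftrightarrow> q = 0 \<or> c = 0"
proof
  assume *: "rat_chain_scale q c = 0"
  show "q = 0 \<or> c = 0"
  proof (rule disjCI)
    assume "c \<noteq> 0"
    then obtain \<sigma> where "Poly_Mapping.lookup c \<sigma> \<noteq> 0"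
      by (metis poly_mapping_eqI lookup_zero)
    then show "q = 0"
      using lookup_rat_chain_scale [of q c \<sigma>] * by simp
  qed
qed auto

text \<open>Induction on \<open>S\<close>: the denominator \<open>b\<close> of the new value is
  multiplied into \<open>N\<close>. Multiplying by \<open>b\<close> keeps the earlier products
  integral.\<close>

lemma common_denominator:
  fixes q :: "'a \<Rightarrow> rat"
  assumes "finite S"
  shows "\<exists>N::int. N \<noteq> 0 \<and> (\<forall>x\<in>S. of_int N * q x \<in> \<int>)"
  using assms
proof (induction S)
  case empty
  show ?case
    by (intro exI [of _ 1]) simp
next
  case (insert x S)
  then obtain N :: int where N: "N \<noteq> 0" "\<forall>x\<in>S. of_int N * q x \<in> \<int>"
    by blast
  obtain a b where ab: "q x = of_int a / of_int b" "b > 0"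
    by (metis quotient_of_denom_pos quotient_of_div surj_pair)
  have "of_int (N * b) * q x \<in> \<int>"
    using ab by simp
  moreover have "of_int (N * b) * q y \<in> \<int>" if "y \<in> S" for y
    using Ints_mult [of "of_int b" "of_int N * q y"] N that by (simp add: mult_ac)
  ultimately show ?case
    using N ab by (intro exI [of _ "N * b"]) auto
qed

text \<open>The scalar is the reciprocal of a common denominator of the finitely many coefficients.
  The bound on the keys keeps \<open>w\<close> in whatever space contains \<open>c\<close>;
  \<open>q \<noteq> 0\<close> allows the scalar to be cancelled later.\<close>

lemma rat_chain_clear_denominators:
  obtains q w where "q \<noteq> 0" "c = rat_chain_scale q (rat_of_chain w)"
    "Poly_Mapping.keys w \<subseteq> Poly_Mapping.keys c"
proof -
  obtain N :: int where N: "N \<noteq> 0"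
      "\<forall>\<sigma>\<in>Poly_Mapping.keys c. of_int N * Poly_Mapping.lookup c \<sigma> \<in> \<int>"
    using common_denominator [OF finite_keys] by metis
  \<comment> \<open>The floor only converts to type \<open>int\<close>: on the keys its argument is
    already integral, and elsewhere it is 0.\<close>
  define w where "w = Poly_Mapping.map (\<lambda>x. \<lfloor>of_int N * x\<rfloor>) c"
  have w: "Poly_Mapping.lookup w \<sigma> = \<lfloor>of_int N * Poly_Mapping.lookup c \<sigma>\<rfloor>" for \<sigma>
    by (simp add: w_def Poly_Mapping.map.rep_eq when_def)
  have "of_int (Poly_Mapping.lookup w \<sigma>) = of_int N * Poly_Mapping.lookup c \<sigma>" for \<sigma>
    using N(2) by (cases "\<sigma> \<in> Poly_Mapping.keys c") (auto simp: w in_keys_iff)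
  then have "c = rat_chain_scale (1 / of_int N) (rat_of_chain w)"
    using N(1) by (auto intro!: poly_mapping_eqI)
  moreover have "Poly_Mapping.keys w \<subseteq> Poly_Mapping.keys c"
    by (auto simp: w in_keys_iff)
  ultimately show ?thesis
    using N(1) by (intro that [of "1 / of_int N" w]) auto
qed

lemma rat_singular_chains_clear_denominators:
  assumes "c \<in> rat_singular_chains p X"
  obtains q w where "q \<noteq> 0" "singular_chain p X w" "c = rat_chain_scale q (rat_of_chain w)"
proof -
  obtain q w where w: "q \<noteq> 0" "c = rat_chain_scale q (rat_of_chain w)"
      "Poly_Mapping.keys w \<subseteq> Poly_Mapping.keys c"
    by (rule rat_chain_clear_denominators)
  then show ?thesis
    using assms by (intro that [of q w]) (auto simp: rat_singular_chains_def singular_chain_def)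
qed

lemma rat_of_chain_in_chains:
  "singular_chain p X w \<Longrightarrow> rat_of_chain w \<in> rat_singular_chains p X"
  by (auto simp: rat_singular_chains_def singular_chain_def in_keys_iff)

lemma rat_of_chain_in_cycles:
  "singular_relcycle p X {} w \<Longrightarrow> rat_of_chain w \<in> rat_singular_cycles p X"
  by (simp add: rat_singular_cycles_def singular_cycle rat_of_chain_in_chains
      rat_chain_boundary_of_chain)

lemma rat_of_chain_in_boundaries:
  assumes "singular_relboundary p X {} w"
  shows "rat_of_chain w \<in> rat_singular_boundaries p X"
proof -
  obtain d where "singular_chain (Suc p) X d" "chain_boundary (Suc p) d = w"
    using assms by (auto simp: singular_boundary)
  then show ?thesis
    unfolding rat_singular_boundaries_def
    by (intro image_eqI [of _ _ "rat_of_chain d"])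
       (simp_all add: rat_chain_boundary_of_chain rat_of_chain_in_chains)
qed

lemma rat_singular_cycles_clear_denominators:
  assumes "z \<in> rat_singular_cycles p X"
  obtains q w where "singular_relcycle p X {} w" "z = rat_chain_scale q (rat_of_chain w)"
proof -
  obtain q w where w: "q \<noteq> 0" "singular_chain p X w" "z = rat_chain_scale q (rat_of_chain w)"
    using assms by (auto simp: rat_singular_cycles_def elim: rat_singular_chains_clear_denominators)
  \<comment> \<open>The boundary of \<open>z\<close> is \<open>q\<close> times the rational image of
    the boundary of \<open>w\<close>. As \<open>q \<noteq> 0\<close> and \<open>rat_of_chain\<close>
    has trivial kernel, the integral boundary vanishes.\<close>
  moreover have "chain_boundary p w = 0"
    using assms w
    by (simp add: rat_singular_cycles_def rat_chain_boundary_scale rat_chain_boundary_of_chain)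
  ultimately show ?thesis
    using that by (simp add: singular_cycle)
qed

text \<open>Denominators are cleared in a chain bounded by \<open>b\<close>, not in \<open>b\<close>
  itself: because of torsion, an integral chain that bounds rationally need not bound
  integrally.\<close>

lemma rat_singular_boundaries_clear_denominators:
  assumes "b \<in> rat_singular_boundaries p X"
  obtains q w where "singular_relboundary p X {} w" "b = rat_chain_scale q (rat_of_chain w)"
proof -
  obtain c where c: "c \<in> rat_singular_chains (Suc p) X" "b = rat_chain_boundary (Suc p) c"
    using assms by (auto simp: rat_singular_boundaries_def)
  from c(1) obtain q d where "singular_chain (Suc p) X d" "c = rat_chain_scale q (rat_of_chain d)"
    by (rule rat_singular_chains_clear_denominators)
  with c show ?thesis
    by (intro that [of "chain_boundary (Suc p) d" q])
       (auto simp: singular_boundary rat_chain_boundary_scale rat_chain_boundary_of_chain)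
qed


section \<open>Induced maps in rational homology\<close>

definition rat_chain_map :: "nat \<Rightarrow> ('a \<Rightarrow> 'b) \<Rightarrow> 'a rat_chain \<Rightarrow> 'b rat_chain" where
  "rat_chain_map p f c =
     (\<Sum>\<sigma>\<in>Poly_Mapping.keys c.
        rat_chain_scale (Poly_Mapping.lookup c \<sigma>) (rat_of_chain (frag_of (simplex_map p f \<sigma>))))"

lemma rat_chain_map_superset:
  assumes "finite S" "Poly_Mapping.keys c \<subseteq> S"
  shows "rat_chain_map p f c =
     (\<Sum>\<sigma>\<in>S. rat_chain_scale (Poly_Mapping.lookup c \<sigma>) (rat_of_chain (frag_of (simplex_map p f \<sigma>))))"
  unfolding rat_chain_map_def using assms
  by (intro sum.mono_neutral_left) (auto simp: in_keys_iff)

lemma rat_chain_map_add: "rat_chain_map p f (c + d) = rat_chain_map p f c + rat_chain_map p f d"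
proof -
  let ?S = "Poly_Mapping.keys c \<union> Poly_Mapping.keys d"
  have "rat_chain_map p f (c + d) = (\<Sum>\<sigma>\<in>?S. rat_chain_scale
      (Poly_Mapping.lookup (c + d) \<sigma>) (rat_of_chain (frag_of (simplex_map p f \<sigma>))))"
    using Poly_Mapping.keys_add by (intro rat_chain_map_superset) simp_all
  then show ?thesis
    by (simp add: rat_chain_map_superset [of ?S c] rat_chain_map_superset [of ?S d]
        Poly_Mapping.lookup_add rat_chain_scale_add(1) sum.distrib)
qed

lemma rat_chain_map_scale:
  "rat_chain_map p f (rat_chain_scale q c) = rat_chain_scale q (rat_chain_map p f c)"
proof -
  have "rat_chain_map p f (rat_chain_scale q c) = (\<Sum>\<sigma>\<in>Poly_Mapping.keys c. rat_chain_scale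
      (Poly_Mapping.lookup (rat_chain_scale q c) \<sigma>) (rat_of_chain (frag_of (simplex_map p f \<sigma>))))"
    using keys_rat_chain_scale by (rule rat_chain_map_superset [OF finite_keys])
  then show ?thesis
    by (simp add: rat_chain_map_def [of p f c] rat_chain_scale_sum)
qed

text \<open>Both sides are additive in \<open>c\<close>, so single simplices decide. With
  denominators cleared, this transfers facts about the integral \<open>chain_map\<close> to rational
  chains.\<close>

lemma rat_chain_map_of_chain: "rat_chain_map p f (rat_of_chain c) = rat_of_chain (chain_map p f c)"
  using subset_UNIV
proof (induction c rule: frag_induction)
  case zero
  show ?case
    by (simp add: rat_chain_map_def)
next
  case (one \<sigma>)
  have "Poly_Mapping.keys (rat_of_chain (frag_of \<sigma>)) \<subseteq> {\<sigma>}"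
    by (auto simp: in_keys_iff lookup_single when_def split: if_splits)
  then show ?case
    by (simp add: rat_chain_map_superset [of "{\<sigma>}"])
next
  case (diff a b)
  have *: "rat_of_chain (x - y) = rat_of_chain x + rat_chain_scale (-1) (rat_of_chain y)"
    for x y :: "'c chain"
    by (auto intro!: poly_mapping_eqI simp: Poly_Mapping.lookup_add Poly_Mapping.lookup_minus)
  from diff show ?case
    by (simp add: * rat_chain_map_add rat_chain_map_scale chain_map_diff)
qed

lemma rat_chain_map_compose:
  "rat_chain_map p (g \<circ> f) c = rat_chain_map p g (rat_chain_map p f c)"
proof -
  obtain q w where "c = rat_chain_scale q (rat_of_chain w)"
    by (rule rat_chain_clear_denominators)
  then show ?thesis
    by (simp add: rat_chain_map_scale rat_chain_map_of_chain chain_map_compose)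
qed

text \<open>\<open>simplex_map\<close> restricts to the standard simplex, so \<open>id\<close> fixes
  only functions that are extensional there. Singular simplices are, and \<open>z\<close> is built
  from them.\<close>

lemma rat_chain_map_ident:
  assumes "z \<in> rat_singular_cycles p X"
  shows "rat_chain_map p id z = z"
proof -
  obtain q w where "singular_relcycle p X {} w" "z = rat_chain_scale q (rat_of_chain w)"
    using assms by (rule rat_singular_cycles_clear_denominators)
  then show ?thesis
    by (simp add: rat_chain_map_scale rat_chain_map_of_chain singular_cycle chain_map_ident [of p X])
qed

lemma rat_chain_map_cycles:
  assumes "continuous_map X Y f" "z \<in> rat_singular_cycles p X"
  shows "rat_chain_map p f z \<in> rat_singular_cycles p Y"
proof -
  obtain q w where "singular_relcycle p X {} w" "z = rat_chain_scale q (rat_of_chain w)"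
    using assms(2) by (rule rat_singular_cycles_clear_denominators)
  then show ?thesis
    using assms(1) singular_relcycle_chain_map [of p X "{}" w Y f "{}"]
    by (simp add: rat_chain_map_scale rat_chain_map_of_chain rat_of_chain_in_cycles)
qed

lemma rat_chain_map_boundaries:
  assumes "continuous_map X Y f" "b \<in> rat_singular_boundaries p X"
  shows "rat_chain_map p f b \<in> rat_singular_boundaries p Y"
proof -
  obtain q w where "singular_relboundary p X {} w" "b = rat_chain_scale q (rat_of_chain w)"
    using assms(2) by (rule rat_singular_boundaries_clear_denominators)
  then show ?thesis
    using assms(1) singular_relboundary_chain_map [of p X "{}" w Y f "{}"]
    by (simp add: rat_chain_map_scale rat_chain_map_of_chain rat_of_chain_in_boundaries)
qed

lemma rat_chain_map_homotopic:
  assumes "homotopic_with (\<lambda>h. True) X Y f g" "z \<in> rat_singular_cycles p X"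
  shows "rat_chain_map p f z - rat_chain_map p g z \<in> rat_singular_boundaries p Y"
proof -
  obtain q w where w: "singular_relcycle p X {} w" "z = rat_chain_scale q (rat_of_chain w)"
    using assms(2) by (rule rat_singular_cycles_clear_denominators)
  have "homologous_rel p Y {} (chain_map p f w) (chain_map p g w)"
    using assms(1) w(1) by (intro homotopic_imp_homologous_rel_chain_maps) simp_all
  \<comment> \<open>The common scalar \<open>q\<close> is pulled out of the difference, which leaves
    the image of an integral boundary.\<close>
  then show ?thesis
    by (simp add: w(2) rat_chain_map_scale rat_chain_map_of_chain homologous_rel_def
        rat_of_chain_in_boundaries flip: rat_chain_scale_diff rat_of_chain_diff)
qed

text \<open>The union over all representatives avoids choosing one. For continuous \<open>f\<close>
  all cosets in it coincide, because \<open>f\<close> sends boundaries to boundaries.\<close>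

definition rat_hom_induced ::
    "nat \<Rightarrow> 'b topology \<Rightarrow> ('a \<Rightarrow> 'b) \<Rightarrow> 'a rat_chain set \<Rightarrow> 'b rat_chain set" where
  "rat_hom_induced p Y f A = (\<Union>z\<in>A. rat_coset p Y (rat_chain_map p f z))"

lemma rat_hom_induced_coset:
  assumes "continuous_map X Y f"
  shows "rat_hom_induced p Y f (rat_coset p X z) = rat_coset p Y (rat_chain_map p f z)"
  unfolding rat_hom_induced_def
proof (rule SUP_eq_const)
  show "rat_coset p X z \<noteq> {}"
    unfolding rat_coset_eq using rat_singular_boundaries_closed(1) by blast
  fix a
  assume "a \<in> rat_coset p X z"
  then obtain b where "b \<in> rat_singular_boundaries p X" "a = b + z"
    unfolding rat_coset_eq by blast
  then show "rat_coset p Y (rat_chain_map p f a) = rat_coset p Y (rat_chain_map p f z)"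
    by (simp only: rat_chain_map_add rat_coset_cong rat_chain_map_boundaries [OF assms])
qed

lemma rat_hom_induced_in_module_hom:
  assumes "continuous_map X Y f"
  shows "rat_hom_induced p Y f \<in> module_hom class_ring (rat_homology p X) (rat_homology p Y)"
  by (auto simp: module_hom_def rat_homology_simps rat_hom_induced_coset [OF assms]
      rat_chain_map_add rat_chain_map_scale rat_chain_map_cycles [OF assms])

text \<open>By the homotopy, the image of a cycle under \<open>g \<circ> f\<close> differs from the
  cycle by a boundary. Applied again with \<open>f\<close> and \<open>g\<close> exchanged, this
  yields surjectivity besides injectivity.\<close>

lemma rat_hom_induced_left_inverse:
  assumes f: "continuous_map X Y f" and g: "continuous_map Y X g"
    and gf: "homotopic_with (\<lambda>h. True) X X (g \<circ> f) id"
    and A: "A \<in> carrier (rat_homology p X)"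
  shows "rat_hom_induced p X g (rat_hom_induced p Y f A) = A"
proof -
  obtain z where z: "z \<in> rat_singular_cycles p X" "A = rat_coset p X z"
    using A by (auto simp: rat_homology_simps)
  have "rat_chain_map p (g \<circ> f) z - z \<in> rat_singular_boundaries p X"
    using rat_chain_map_homotopic [OF gf z(1)] by (simp add: rat_chain_map_ident [OF z(1)])
  then have "rat_coset p X (rat_chain_map p (g \<circ> f) z) = rat_coset p X z"
    using rat_coset_cong [of "rat_chain_map p (g \<circ> f) z - z" p X z] by simp
  then show ?thesis
    by (simp add: z(2) rat_hom_induced_coset [OF f] rat_hom_induced_coset [OF g]
        rat_chain_map_compose)
qed

section \<open>Classes of loops under continuous maps\<close>

lemma loop_class_homologous_rel_set:
  assumes "continuous_map (nsphere 1) X C" "singular_relcycle 1 (nsphere 1) {} c"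
  shows "loop_class (homologous_rel_set 1 (nsphere 1) {} c) X C =
     rat_coset 1 X (rat_of_chain (chain_map 1 C c))"
  using hom_induced_chain_map [OF assms(1) _ assms(2), of "{}"]
  by (simp add: loop_class_def rat_homology_class_coset)

text \<open>Once \<gamma> is represented by an integral cycle \<open>c\<close>, both sides are the
  coset of \<open>c\<close> pushed forward along \<open>f \<circ> C\<close>.\<close>

lemma loop_class_compose:
  assumes f: "continuous_map X Y f" and C: "continuous_map (nsphere 1) X C"
    and \<gamma>: "\<gamma> \<in> carrier (homology_group 1 (nsphere 1))"
  shows "loop_class \<gamma> Y (f \<circ> C) = rat_hom_induced 1 Y f (loop_class \<gamma> X C)"
proof -
  obtain c where c: "singular_relcycle 1 (nsphere 1) {} c"
      "\<gamma> = homologous_rel_set 1 (nsphere 1) {} c"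
    using \<gamma> carrier_relative_homology_group [of 1 "nsphere 1" "{}"] by auto
  show ?thesis
    unfolding c(2) loop_class_homologous_rel_set [OF C c(1)]
      loop_class_homologous_rel_set [OF continuous_map_compose [OF C f] c(1)]
    by (simp only: rat_hom_induced_coset [OF f] rat_chain_map_of_chain chain_map_compose o_apply)
qed


section \<open>Cycle bases under homotopy equivalences\<close>

lemma cycle_basis_homotopy_equivalence:
  assumes f: "continuous_map X Y f" and g: "continuous_map Y X g"
    and gf: "homotopic_with (\<lambda>h. True) X X (g \<circ> f) id"
    and fg: "homotopic_with (\<lambda>h. True) Y Y (f \<circ> g) id"
    and \<gamma>: "\<gamma> \<in> carrier (homology_group 1 (nsphere 1))"
    and C: "cycle_basis \<gamma> X n C"
  shows "cycle_basis \<gamma> Y n (\<lambda>i. f \<circ> C i)"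
proof -
  let ?K = "class_ring :: rat ring"
  let ?f = "rat_hom_induced 1 Y f" and ?g = "rat_hom_induced 1 X g"
  let ?B = "(\<lambda>i. loop_class \<gamma> X (C i)) ` {1..n}"
  interpret HX: vectorspace ?K "rat_homology 1 X"
    by (rule vectorspace_rat_homology)
  interpret HY: vectorspace ?K "rat_homology 1 Y"
    by (rule vectorspace_rat_homology)
  interpret linear_map ?K "rat_homology 1 X" "rat_homology 1 Y" ?f
    by unfold_locales (rule rat_hom_induced_in_module_hom [OF f])
  have cont: "\<And>i. i \<in> {1..n} \<Longrightarrow> continuous_map (nsphere 1) X (C i)"
    and inj: "inj_on (\<lambda>i. loop_class \<gamma> X (C i)) {1..n}"
    and basis: "HX.basis ?B"
    using C by (auto simp: cycle_basis_def)
  have class_eq: "\<And>i. i \<in> {1..n} \<Longrightarrow> loop_class \<gamma> Y (f \<circ> C i) = ?f (loop_class \<gamma> X (C i))"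
    by (rule loop_class_compose [OF f cont \<gamma>])
  have f_closed: "?f ` carrier (rat_homology 1 X) \<subseteq> carrier (rat_homology 1 Y)"
    using module_hom_closed [OF rat_hom_induced_in_module_hom [OF f]] by blast
  have inj_f: "inj_on ?f (carrier (rat_homology 1 X))"
    by (rule inj_on_inverseI) (rule rat_hom_induced_left_inverse [OF f g gf])
  have "A \<in> ?f ` carrier (rat_homology 1 X)" if A: "A \<in> carrier (rat_homology 1 Y)" for A
  proof
    show "A = ?f (?g A)"
      using rat_hom_induced_left_inverse [OF g f fg A] by simp
    show "?g A \<in> carrier (rat_homology 1 X)"
      using module_hom_closed [OF rat_hom_induced_in_module_hom [OF g]] A by blast
  qed
  with f_closed have surj_f: "?f ` carrier (rat_homology 1 X) = carrier (rat_homology 1 Y)"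
    by blast
  \<comment> \<open>The transport of bases along a linear bijection asks for finite dimension; the
    given basis, indexed by \<open>{1..n}\<close>, witnesses it.\<close>
  have "HX.fin_dim"
    using basis unfolding HX.fin_dim_def HX.basis_def
    by (intro exI [of _ ?B] conjI finite_imageI finite_atLeastAtMost) simp_all
  then have "HY.basis (?f ` ?B)"
    by (rule linear_inj_image_is_basis [OF inj_f surj_f basis])
  moreover have "?f ` ?B = (\<lambda>i. loop_class \<gamma> Y (f \<circ> C i)) ` {1..n}"
    unfolding image_image by (rule image_cong) (simp_all add: class_eq)
  moreover have "inj_on (\<lambda>i. loop_class \<gamma> Y (f \<circ> C i)) {1..n}"
  proof -
    \<comment> \<open>Basis vectors lie in the carrier, where \<open>?f\<close> is injective. Hence
      classes with distinct indices stay distinct, as a basis taken as a family requires.\<close>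
    have "inj_on ?f ?B"
      using basis unfolding HX.basis_def by (intro inj_on_subset [OF inj_f]) simp
    with inj have "inj_on (?f \<circ> (\<lambda>i. loop_class \<gamma> X (C i))) {1..n}"
      by (rule comp_inj_on)
    then show ?thesis
      by (subst inj_on_cong [where g = "?f \<circ> (\<lambda>i. loop_class \<gamma> X (C i))"]) (simp_all add: class_eq)
  qed
  ultimately show ?thesis
    using continuous_map_compose [OF cont f] by (auto simp: cycle_basis_def)
qed

section \<open>The projection to the graph as a homotopy equivalence\<close>

theorem theorem4p1:
  fixes V :: "'v set" and E :: "('v \<times> 'v) set"
    and t\<^sub>s t\<^sub>e t\<^sub>0 :: real
    and \<gamma> :: "(nat \<Rightarrow> real) chain set"
    and n :: nat
    and C :: "nat \<Rightarrow> (nat \<Rightarrow> real) \<Rightarrow> (('v + 'v \<times> 'v) \<times> real) set \<times> real"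
  assumes "finite V" and "E \<subseteq> V \<times> V"
    and "t\<^sub>s \<le> t\<^sub>e" and "t\<^sub>0 \<in> {t\<^sub>s..t\<^sub>e}"
    and "circle_generator \<gamma>"
    and "cycle_basis \<gamma> (prod_topology (graph_space V E) (top_of_set {t\<^sub>s..t\<^sub>e})) n C"
  shows "cycle_basis \<gamma> (graph_space V E) n (\<lambda>i. fst \<circ> time_slice t\<^sub>0 \<circ> C i)"
proof -
  let ?X = "graph_space V E" and ?I = "top_of_set {t\<^sub>s..t\<^sub>e}"
  \<comment> \<open>The section at height \<open>t\<^sub>0\<close> serves as homotopy inverse of
    \<open>fst\<close>; \<open>t\<^sub>0\<close> lying in the interval makes it map into the
    product.\<close>
  let ?s = "\<lambda>x. (x, t\<^sub>0)"
  have s: "continuous_map ?X (prod_topology ?X ?I) ?s"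
    using assms(4) by (simp add: continuous_map_pairwise o_def)
  have "contractible_space ?I"
    by (simp only: contractible_space_top_of_set convex_imp_contractible convex_real_interval)
  then have "homotopic_with (\<lambda>h. True) ?I ?I (\<lambda>t. t\<^sub>0) id"
    using assms(4) by (intro homotopic_into_contractible_space) auto
  then have "homotopic_with (\<lambda>h. True) (prod_topology ?X ?I) (prod_topology ?X ?I)
      (\<lambda>z. (id (fst z), t\<^sub>0)) (\<lambda>z. (id (fst z), id (snd z)))"
    \<comment> \<open>The stationary homotopy on the graph is multiplied by a contraction of the
      interval to \<open>t\<^sub>0\<close>.\<close>
    using homotopic_with_prod_topology [of "\<lambda>h. True" ?X ?X id id "\<lambda>h. True" ?I ?I "\<lambda>t. t\<^sub>0" id]
    by (simp add: case_prod_unfold)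
  moreover have "(\<lambda>z. (id (fst z), t\<^sub>0)) = ?s \<circ> fst" "(\<lambda>z. (id (fst z), id (snd z))) = id"
    by auto
  ultimately have "homotopic_with (\<lambda>h. True) (prod_topology ?X ?I) (prod_topology ?X ?I) (?s \<circ> fst) id"
    by metis
  \<comment> \<open>Here the composite equals the identity outright, so reflexivity
    suffices.\<close>
  moreover have "homotopic_with (\<lambda>h. True) ?X ?X (fst \<circ> ?s) id"
    by (simp add: o_def id_def)
  ultimately have "cycle_basis \<gamma> ?X n (\<lambda>i. fst \<circ> C i)"
    using assms(5,6) s
    by (intro cycle_basis_homotopy_equivalence [of "prod_topology ?X ?I" _ fst ?s])
       (auto simp: circle_generator_def continuous_map_fst)
  \<comment> \<open>\<open>time_slice\<close> alters only the time coordinate, which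
    \<open>fst\<close> discards.\<close>
  moreover have "fst \<circ> time_slice t\<^sub>0 \<circ> C i = fst \<circ> C i" for i
    by (simp add: fun_eq_iff time_slice_def case_prod_unfold)
  ultimately show ?thesis
    by simp
qed

end
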